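(* Let $(M,g)$ be a Riemannian manifold and let $\phi : M \to \mathbb{C}$ be a complex isoparametric function on $M$ with $$\tau(\phi) = \Phi \circ \phi \quad\text{and}\quad \kappa(\phi,\phi) = \Psi \circ \phi,$$ for some holomorphic functions $\Phi,\Psi : U \to\mathbb{C}$ defined on an open set $U$ of $\mathbb{C}$ containing $\phi(M)$. Suppose that one of the following situations holds. (1) If $\Psi$ vanishes identically, let $\hat{U}$ be an open simply connected subset of $U \setminus \Phi^{-1}(\{0\})$ and define the holomorphic functions $f_r : \hat{U} \to \mathbb{C}$ for $r \geq 1$ by $$f_r(z) = c \left(\int^z \frac{\mathrm d\zeta}{\Phi(\zeta)}\right)^{r-1},$$ where $c \in \mathbb{C}$ is non-zero. (2) If $\Psi$ does not vanish identically, let $\hat{U}$ be an open simply connected subset of $U \setminus \Psi^{-1}(\{0\})$, put $$\Lambda(z) = \exp\left(-\int^z \frac{\Phi(\zeta)}{\Psi(\zeta)} \,\mathrm d\zeta\right), \quad z \in \hat{U},$$ and define the holomorphic functions $f_r : \hat{U} \to \mathbb{C}$ for $r \geq 1$ by $$f_1(z) = c_1 \int^z \Lambda(\zeta) \, \mathrm d\zeta + c_2,$$ $$f_r(z) = \int^z \Lambda(\eta) \int^\eta \frac{f_{r-1}(\zeta)}{\Lambda(\zeta)\,\Psi(\zeta)} \, \mathrm d\zeta \,\mathrm d\eta, \quad r > 1,$$ where $c = (c_1, c_2) \in \mathbb{C}^2$ is non-zero. Then in both cases, the composition $$f_r \circ \phi : \phi^{-1} (\hat{U}) \to \mathbb{C}$$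 is proper $r$-harmonic on its open domain $\phi^{-1} (\hat{U})$ in $M$ for all $r \geq 1$.
   Context: Let $(M,g)$ be a Riemannian manifold, with $g$ extended to a complex bilinear form on the complexified tangent bundle $T^{\mathbb{C}}M$. For smooth $\phi,\psi:M\to\mathbb{C}$, the gradient $\nabla\phi$ is a section of $T^{\mathbb{C}}M$, and $$\tau(\phi)=\operatorname{div}(\nabla\phi)=\frac{1}{\sqrt{\det g}}\sum_{ij}\frac{\partial}{\partial x_j}\left(g^{ij}\sqrt{\det g}\,\frac{\partial\phi}{\partial x_i}\right)$$ is the (linear) Laplace-Beltrami operator (tension field), while $\kappa(\phi,\psi)=g(\nabla\phi,\nabla\psi)$ is the (complex bilinear) conformality operator. Put $\tau^0(\phi)=\phi$ and $\tau^r(\phi)=\tau(\tau^{r-1}(\phi))$ for $r\ge1$. For a positive integer $r$, a smooth complex-valued function $\phi$ is proper $r$-harmonic if $\tau^r(\phi)=0$ and $\tau^{r-1}(\phi)$ does not vanish identically. A smooth function $\phi:M\to\mathbb{C}$ is complex isoparametric on $M$ if there exist holomorphic functions $\Phi,\Psi:U\to\mathbb{C}$ defined on some open set $U\subset\mathbb{C}$ containing $\phi(M)$ such that $\tau(\phi)=\Phi\circ\phi$ and $\kappa(\phi,\phi)=\Psi\circ\phi$. The notation $\int^z h(\zeta)\,\mathrm d\zeta$ denotes a holomorphic antiderivative of $h$ on $\hat U$; the simple connectedness of $\hat U$ ensures that such antiderivatives are well-defined. *)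

theory Defs
  imports "HOL-Complex_Analysis.Complex_Analysis"
begin

section \<open>Smooth maps between Euclidean spaces\<close>

text \<open>
  \<open>Ck_on k f S\<close> is meant for open sets \<open>S\<close>: all iterated directional derivatives of \<open>f\<close> of order
  at most \<open>k\<close> exist as continuous functions (for finite-dimensional domains this is \<open>C\<^sup>k\<close>).
\<close>

fun Ck_on :: "nat \<Rightarrow> ('e::euclidean_space \<Rightarrow> 'b::real_normed_vector) \<Rightarrow> 'e set \<Rightarrow> bool" where
  "Ck_on 0 f S \<longleftrightarrow> continuous_on S f"
| "Ck_on (Suc k) f S \<longleftrightarrow>
     (\<forall>x\<in>S. f differentiable (at x)) \<and> (\<forall>v. Ck_on k (\<lambda>x. frechet_derivative f (at x) v) S)"

definition smooth_on :: "('e::euclidean_space \<Rightarrow> 'b::real_normed_vector) \<Rightarrow> 'e set \<Rightarrow> bool" where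
  "smooth_on f S \<longleftrightarrow> (\<forall>k. Ck_on k f S)"

definition partial_deriv :: "'n::finite \<Rightarrow> (real^'n \<Rightarrow> complex) \<Rightarrow> real^'n \<Rightarrow> complex" where
  "partial_deriv i h x = frechet_derivative h (at x) (axis i 1)"


section \<open>Smooth manifolds\<close>

text \<open>
  A manifold is a topological space \<open>X\<close> with carrier \<open>topspace X\<close> and a (not necessarily maximal)
  smooth atlas \<open>A\<close>. A chart is a pair \<open>(D, x)\<close> of a domain and a coordinate map; the values of \<open>x\<close>
  outside \<open>D\<close> are irrelevant.
\<close>

type_synonym ('a, 'n) chart = "'a set \<times> ('a \<Rightarrow> real^'n)"

definition chart_inv :: "('a, 'n) chart \<Rightarrow> real^'n \<Rightarrow> 'a" where
  "chart_inv \<kappa> = inv_into (fst \<kappa>) (snd \<kappa>)"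

locale smooth_manifold =
  fixes X :: "'a topology" and A :: "('a, 'n::finite) chart set"
  assumes Hausdorff: "Hausdorff_space X"
    and second_countable: "second_countable X"
    and chart_domain_open: "\<And>\<kappa>. \<kappa> \<in> A \<Longrightarrow> openin X (fst \<kappa>)"
    and chart_image_open: "\<And>\<kappa>. \<kappa> \<in> A \<Longrightarrow> open (snd \<kappa> ` fst \<kappa>)"
    and chart_homeomorphic:
      "\<And>\<kappa>. \<kappa> \<in> A \<Longrightarrow>
        homeomorphic_map (subtopology X (fst \<kappa>)) (top_of_set (snd \<kappa> ` fst \<kappa>)) (snd \<kappa>)"
    and charts_cover: "(\<Union>\<kappa>\<in>A. fst \<kappa>) = topspace X"
    and charts_compatible:
      "\<And>\<kappa> \<mu>. \<kappa> \<in> A \<Longrightarrow> \<mu> \<in> A \<Longrightarrow>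
        smooth_on (snd \<mu> \<circ> chart_inv \<kappa>) (snd \<kappa> ` (fst \<kappa> \<inter> fst \<mu>))"

definition smooth_fun_on :: "('a, 'n::finite) chart set \<Rightarrow> ('a \<Rightarrow> complex) \<Rightarrow> 'a set \<Rightarrow> bool" where
  "smooth_fun_on A \<phi> W \<longleftrightarrow>
    (\<forall>\<kappa>\<in>A. smooth_on (\<phi> \<circ> chart_inv \<kappa>) (snd \<kappa> ` (fst \<kappa> \<inter> W)))"


section \<open>Riemannian metrics\<close>

text \<open>
  The metric is a smooth symmetric positive definite covariant 2-tensor, given by its components:
  \<open>g \<kappa> p $ i $ j\<close> is the value at \<open>p\<close> of the metric on the coordinate vector fields
  \<open>\<partial>/\<partial>x\<^sub>i\<close>, \<open>\<partial>/\<partial>x\<^sub>j\<close> of the chart \<open>\<kappa>\<close>. The last axiom is the tensor transformation law.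
\<close>

type_synonym ('a, 'n) metric = "('a, 'n) chart \<Rightarrow> 'a \<Rightarrow> real^'n^'n"

locale riemannian_manifold = smooth_manifold X A
  for X :: "'a topology" and A :: "('a, 'n::finite) chart set" +
  fixes g :: "('a, 'n) metric"
  assumes metric_symmetric: "\<And>\<kappa> p. \<kappa> \<in> A \<Longrightarrow> p \<in> fst \<kappa> \<Longrightarrow> transpose (g \<kappa> p) = g \<kappa> p"
    and metric_pos_def:
      "\<And>\<kappa> p v. \<kappa> \<in> A \<Longrightarrow> p \<in> fst \<kappa> \<Longrightarrow> v \<noteq> 0 \<Longrightarrow> v \<bullet> (g \<kappa> p *v v) > 0"
    and metric_smooth:
      "\<And>\<kappa> i j. \<kappa> \<in> A \<Longrightarrow> smooth_on (\<lambda>x. g \<kappa> (chart_inv \<kappa> x) $ i $ j) (snd \<kappa> ` fst \<kappa>)"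
    and metric_transform:
      "\<And>\<kappa> \<mu> p. \<kappa> \<in> A \<Longrightarrow> \<mu> \<in> A \<Longrightarrow> p \<in> fst \<kappa> \<inter> fst \<mu> \<Longrightarrow>
        (let J = jacobian (snd \<mu> \<circ> chart_inv \<kappa>) (at (snd \<kappa> p))
         in g \<kappa> p = transpose J ** g \<mu> p ** J)"


section \<open>Tension field and conformality operator\<close>

text \<open>
  The operators are given by their expressions in a chart around the point. For smooth functions
  these do not depend on the chart, so the choice made by \<open>chart_at\<close> is immaterial. They are local:
  the values at a point of an open set \<open>W\<close> depend only on the functions on \<open>W\<close>, so that they also
  serve as the operators of the open submanifold \<open>W\<close>.
\<close>

definition chart_at :: "('a, 'n) chart set \<Rightarrow> 'a \<Rightarrow> ('a, 'n) chart" where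
  "chart_at A p = (SOME \<kappa>. \<kappa> \<in> A \<and> p \<in> fst \<kappa>)"

definition tension_in ::
    "('a, 'n::finite) metric \<Rightarrow> ('a, 'n) chart \<Rightarrow> ('a \<Rightarrow> complex) \<Rightarrow> real^'n \<Rightarrow> complex" where
  "tension_in g \<kappa> \<phi> x =
    (let G = (\<lambda>y. g \<kappa> (chart_inv \<kappa> y)) in
      1 / of_real (sqrt (det (G x))) *
      (\<Sum>i\<in>UNIV. \<Sum>j\<in>UNIV. partial_deriv j
         (\<lambda>y. of_real (matrix_inv (G y) $ i $ j * sqrt (det (G y)))
               * partial_deriv i (\<phi> \<circ> chart_inv \<kappa>) y) x))"

definition tension ::
    "('a, 'n::finite) chart set \<Rightarrow> ('a, 'n) metric \<Rightarrow> ('a \<Rightarrow> complex) \<Rightarrow> 'a \<Rightarrow> complex" where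
  "tension A g \<phi> p = (let \<kappa> = chart_at A p in tension_in g \<kappa> \<phi> (snd \<kappa> p))"

text \<open>
  Components of the gradient, a section of the complexified tangent bundle, with respect to the
  coordinate vector fields of \<open>\<kappa>\<close>.
\<close>

definition gradient_in ::
    "('a, 'n::finite) metric \<Rightarrow> ('a, 'n) chart \<Rightarrow> ('a \<Rightarrow> complex) \<Rightarrow> 'a \<Rightarrow> complex^'n" where
  "gradient_in g \<kappa> \<phi> p =
    (\<chi> i. \<Sum>j\<in>UNIV. of_real (matrix_inv (g \<kappa> p) $ i $ j)
                     * partial_deriv j (\<phi> \<circ> chart_inv \<kappa>) (snd \<kappa> p))"

text \<open>Complex bilinear (not Hermitian) extension of the metric.\<close>

definition metric_bilinear ::
    "('a, 'n::finite) metric \<Rightarrow> ('a, 'n) chart \<Rightarrow> 'a \<Rightarrow> complex^'n \<Rightarrow> complex^'n \<Rightarrow> complex" where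
  "metric_bilinear g \<kappa> p v w = (\<Sum>i\<in>UNIV. \<Sum>j\<in>UNIV. of_real (g \<kappa> p $ i $ j) * v $ i * w $ j)"

definition conformality ::
    "('a, 'n::finite) chart set \<Rightarrow> ('a, 'n) metric \<Rightarrow> ('a \<Rightarrow> complex) \<Rightarrow> ('a \<Rightarrow> complex)
      \<Rightarrow> 'a \<Rightarrow> complex" where
  "conformality A g \<phi> \<psi> p =
    (let \<kappa> = chart_at A p
     in metric_bilinear g \<kappa> p (gradient_in g \<kappa> \<phi> p) (gradient_in g \<kappa> \<psi> p))"


section \<open>Proper harmonic and complex isoparametric functions\<close>

definition proper_r_harmonic_on ::
    "'a topology \<Rightarrow> ('a, 'n::finite) chart set \<Rightarrow> ('a, 'n) metric \<Rightarrow> nat \<Rightarrow> ('a \<Rightarrow> complex)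
      \<Rightarrow> 'a set \<Rightarrow> bool" where
  "proper_r_harmonic_on X A g r \<phi> W \<longleftrightarrow>
    r \<ge> 1 \<and> openin X W \<and> smooth_fun_on A \<phi> W \<and>
    (\<forall>p\<in>W. (tension A g ^^ r) \<phi> p = 0) \<and>
    \<not> (\<forall>p\<in>W. (tension A g ^^ (r - 1)) \<phi> p = 0)"

definition complex_isoparametric ::
    "'a topology \<Rightarrow> ('a, 'n::finite) chart set \<Rightarrow> ('a, 'n) metric \<Rightarrow> ('a \<Rightarrow> complex) \<Rightarrow> bool" where
  "complex_isoparametric X A g \<phi> \<longleftrightarrow>
    smooth_fun_on A \<phi> (topspace X) \<and>
    (\<exists>U \<Phi> \<Psi>. open U \<and> \<phi> ` topspace X \<subseteq> U \<and> \<Phi> holomorphic_on U \<and> \<Psi> holomorphic_on U \<and>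
      (\<forall>p\<in>topspace X. tension A g \<phi> p = \<Phi> (\<phi> p)) \<and>
      (\<forall>p\<in>topspace X. conformality A g \<phi> \<phi> p = \<Psi> (\<phi> p)))"


section \<open>Holomorphic antiderivatives\<close>

definition antiderivative_on :: "complex set \<Rightarrow> (complex \<Rightarrow> complex) \<Rightarrow> (complex \<Rightarrow> complex) \<Rightarrow> bool" where
  "antiderivative_on S h H \<longleftrightarrow> (\<forall>z\<in>S. (H has_field_derivative h z) (at z))"

lemma antiderivative_on_exists:
  assumes "open S" "simply_connected S" "h holomorphic_on S"
  shows "\<exists>H. antiderivative_on S h H"
  using assms simply_connected_eq_global_primitive[of S]
  unfolding antiderivative_on_def by metis

end

theory Submission
  imports Defs
begin

text \<open>
  In a chart the chain rule gives \<open>\<tau>(h \<circ> \<phi>) = h'(\<phi>) \<tau>(\<phi>) + h''(\<phi>) \<kappa>(\<phi>, \<phi>)\<close> for holomorphic \<open>h\<close>, so on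
  compositions with an isoparametric \<open>\<phi>\<close> the tension field acts as the ordinary differential operator
  \<open>h \<mapsto> \<Phi> h' + \<Psi> h''\<close>. The functions \<open>f\<^sub>r\<close> solve the corresponding recursion: if \<open>\<Psi> = 0\<close>, the operator
  is differentiation with respect to \<open>F = \<integral> 1/\<Phi>\<close>, so it lowers the power of \<open>F\<close>; otherwise \<open>\<Lambda>\<close> is an
  integrating factor and the operator maps \<open>f\<^sub>r\<close> to \<open>f\<^sub>r\<^sub>-\<^sub>1\<close> and annihilates \<open>f\<^sub>1\<close>. Properness of \<open>f\<^sub>1\<close> in the
  second case holds because \<open>f\<^sub>1 \<circ> \<phi> = 0\<close> would force \<open>d\<phi> = 0\<close>, hence \<open>\<Psi> \<circ> \<phi> = \<kappa>(\<phi>, \<phi>) = 0\<close>.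
\<close>

no_notation fps_nth (infixl \<open>$\<close> 75)

section \<open>Calculus of \<open>C\<^sup>k\<close> functions\<close>

text \<open>\<open>frechet_derivative\<close> is a Hilbert choice, so the two sides agree, even at
  points without a derivative, as soon as \<open>has_derivative\<close> accepts the same linear maps
  for both functions.\<close>

lemma frechet_derivative_cong_eventually:
  assumes "eventually (\<lambda>y. f y = g y) (nhds x)"
  shows "frechet_derivative f (at x) = frechet_derivative g (at x)"
proof -
  have ev: "eventually (\<lambda>y. f y = g y) (at x)" "f x = g x"
    using assms by (simp_all add: eventually_nhds_conv_at)
  then have ev': "eventually (\<lambda>y. g y = f y) (at x)"
    by (simp add: eq_commute)
  have "(f has_derivative D) (at x) \<longleftrightarrow> (g has_derivative D) (at x)" for D
    using has_derivative_transform_eventually[OF _ ev]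
      has_derivative_transform_eventually[OF _ ev' ev(2)[symmetric]] by blast
  then show ?thesis
    by (simp add: frechet_derivative_def)
qed

lemma differentiable_cong_open:
  assumes "f differentiable (at x)" "open S" "x \<in> S" "\<And>y. y \<in> S \<Longrightarrow> f y = g y"
  shows "g differentiable (at x)"
  using assms unfolding differentiable_def
  by (meson has_derivative_transform_within_open)

lemma frechet_derivative_add:
  assumes "f differentiable (at x)" "g differentiable (at x)"
  shows "frechet_derivative (\<lambda>y. f y + g y) (at x) v
    = frechet_derivative f (at x) v + frechet_derivative g (at x) v"
  using fun_cong[OF frechet_derivative_at[OF has_derivative_add[OF assms[unfolded frechet_derivative_works]]], of v]
  by simp

lemma frechet_derivative_mult:
  fixes f g :: "'e::euclidean_space \<Rightarrow> 'b::real_normed_algebra"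
  assumes "f differentiable (at x)" "g differentiable (at x)"
  shows "frechet_derivative (\<lambda>y. f y * g y) (at x) v
    = f x * frechet_derivative g (at x) v + frechet_derivative f (at x) v * g x"
  using fun_cong[OF frechet_derivative_at[OF has_derivative_mult[OF assms[unfolded frechet_derivative_works]]], of v]
  by simp

text \<open>The derivative of \<open>h\<close> is multiplication by \<open>d\<close>, in particular
  a real-linear map, and so composes with the real derivative of \<open>u\<close>.\<close>

lemma has_derivative_field_compose:
  assumes "(h has_field_derivative d) (at (u x))" "u differentiable (at x)"
  shows "((\<lambda>y. h (u y)) has_derivative (\<lambda>v. d * frechet_derivative u (at x) v)) (at x)"
  using diff_chain_at[OF assms(2)[unfolded frechet_derivative_works]
      assms(1)[unfolded has_field_derivative_def]]
  by (simp add: o_def)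

lemma frechet_derivative_field_compose:
  assumes "(h has_field_derivative d) (at (u x))" "u differentiable (at x)"
  shows "frechet_derivative (\<lambda>y. h (u y)) (at x) v = d * frechet_derivative u (at x) v"
  using fun_cong[OF frechet_derivative_at[OF has_derivative_field_compose[OF assms]], of v] by simp

section \<open>Closure properties of \<open>Ck_on\<close>\<close>

lemma Ck_on_subset:
  assumes "Ck_on k f S" "T \<subseteq> S"
  shows "Ck_on k f T"
  using assms by (induction k arbitrary: f) (auto intro: continuous_on_subset)

text \<open>The recursion of \<open>Ck_on\<close> asks for derivatives but does not list the lower
  orders; at the bottom, differentiability supplies the continuity.\<close>

lemma Ck_on_SucD:
  assumes "Ck_on (Suc k) f S"
  shows "Ck_on k f S"
  using assms
proof (induction k arbitrary: f)
  case 0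
  then show ?case
    by (auto intro: continuous_at_imp_continuous_on differentiable_imp_continuous_within)
next
  case (Suc k)
  have "Ck_on k (\<lambda>x. frechet_derivative f (at x) v) S" for v
    using Suc.prems by (intro Suc.IH) simp
  then show ?case
    using Suc.prems by simp
qed

lemma Ck_on_cong_open:
  assumes "Ck_on k f S" "open S" "\<And>y. y \<in> S \<Longrightarrow> f y = g y"
  shows "Ck_on k g S"
  using assms
proof (induction k arbitrary: f g)
  case 0
  then show ?case
    by (auto cong: continuous_on_cong)
next
  case (Suc k)
  have "g differentiable (at x)" if "x \<in> S" for x
    using Suc.prems that differentiable_cong_open by (metis Ck_on.simps(2))
  moreover have D: "frechet_derivative f (at x) = frechet_derivative g (at x)" if "x \<in> S" for x
    using Suc.prems that by (intro frechet_derivative_cong_eventually eventually_nhds_in_open[THEN eventually_mono]) auto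
  have "Ck_on k (\<lambda>x. frechet_derivative g (at x) v) S" for v
  proof (rule Suc.IH)
    show "Ck_on k (\<lambda>x. frechet_derivative f (at x) v) S"
      using Suc.prems by simp
  qed (use Suc.prems(2) D in auto)
  ultimately show ?case
    by simp
qed

lemma Ck_on_add:
  assumes "Ck_on k f S" "Ck_on k g S" "open S"
  shows "Ck_on k (\<lambda>x. f x + g x) S"
  using assms
proof (induction k arbitrary: f g)
  case 0
  then show ?case
    by (simp add: continuous_on_add)
next
  case (Suc k)
  have "Ck_on k (\<lambda>x. frechet_derivative f (at x) v + frechet_derivative g (at x) v) S" for v
    using Suc.prems by (intro Suc.IH) auto
  then have "Ck_on k (\<lambda>x. frechet_derivative (\<lambda>y. f y + g y) (at x) v) S" for v
    by (rule Ck_on_cong_open) (use Suc.prems in \<open>auto simp: frechet_derivative_add\<close>)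
  then show ?case
    using Suc.prems by simp
qed

text \<open>The Leibniz formula contains undifferentiated factors, which \<open>Ck_on_SucD\<close>
  lowers to order \<open>k\<close> so that the induction hypothesis covers both summands.\<close>

lemma Ck_on_mult:
  fixes f g :: "'e::euclidean_space \<Rightarrow> 'b::real_normed_algebra"
  assumes "Ck_on k f S" "Ck_on k g S" "open S"
  shows "Ck_on k (\<lambda>x. f x * g x) S"
  using assms
proof (induction k arbitrary: f g)
  case 0
  then show ?case
    by (simp add: continuous_on_mult)
next
  case (Suc k)
  have "Ck_on k (\<lambda>x. f x * frechet_derivative g (at x) v + frechet_derivative f (at x) v * g x) S" for v
    using Suc.prems Suc.prems(1,2)[THEN Ck_on_SucD] by (intro Ck_on_add Suc.IH) auto
  then have "Ck_on k (\<lambda>x. frechet_derivative (\<lambda>y. f y * g y) (at x) v) S" for v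
    by (rule Ck_on_cong_open) (use Suc.prems in \<open>auto simp: frechet_derivative_mult\<close>)
  then show ?case
    using Suc.prems by (auto intro: differentiable_mult)
qed

text \<open>The derivative of the composition is \<open>deriv h (u x)\<close> times a derivative of
  \<open>u\<close>, and \<open>deriv h\<close> is again holomorphic on \<open>V\<close>. Hence the
  induction keeps \<open>h\<close> arbitrary and is applied to \<open>deriv h\<close>.\<close>

lemma Ck_on_holomorphic_compose:
  assumes "Ck_on k u S" "open S" "h holomorphic_on V" "open V" "u ` S \<subseteq> V"
  shows "Ck_on k (\<lambda>x. h (u x)) S"
  using assms
proof (induction k arbitrary: h)
  case 0
  then show ?case
    by (auto intro: continuous_on_compose2 holomorphic_on_imp_continuous_on)
next
  case (Suc k)
  have h: "(h has_field_derivative deriv h (u x)) (at (u x))" if "x \<in> S" for x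
    using Suc.prems that by (auto intro: holomorphic_derivI)
  have u: "u differentiable (at x)" if "x \<in> S" for x
    using Suc.prems(1) that by simp
  have "Ck_on k (\<lambda>x. deriv h (u x) * frechet_derivative u (at x) v) S" for v
    using Suc.prems Ck_on_SucD[OF Suc.prems(1)]
    by (intro Ck_on_mult Suc.IH[of "deriv h"] holomorphic_deriv) auto
  then have "Ck_on k (\<lambda>x. frechet_derivative (\<lambda>y. h (u y)) (at x) v) S" for v
    by (rule Ck_on_cong_open[OF _ Suc.prems(2)]) (rule frechet_derivative_field_compose[OF h u, symmetric])
  moreover have "(\<lambda>y. h (u y)) differentiable (at x)" if "x \<in> S" for x
    using has_derivative_field_compose[OF h u] that by (auto simp: differentiable_def)
  ultimately show ?case
    by simp
qed

lemma smooth_on_continuous: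
  assumes "smooth_on f S"
  shows "continuous_on S f"
  using assms unfolding smooth_on_def by (metis Ck_on.simps(1))

lemma smooth_on_differentiable:
  assumes "smooth_on f S" "x \<in> S"
  shows "f differentiable (at x)"
  using assms unfolding smooth_on_def by (auto dest: spec[of _ "Suc 0"])

lemma smooth_on_frechet_derivative:
  assumes "smooth_on f S"
  shows "smooth_on (\<lambda>x. frechet_derivative f (at x) v) S"
  unfolding smooth_on_def
proof
  show "Ck_on k (\<lambda>x. frechet_derivative f (at x) v) S" for k
    using assms[unfolded smooth_on_def, rule_format, of "Suc k"] by simp
qed


section \<open>The chain rule in a chart\<close>

lemma partial_deriv_cong_eventually:
  assumes "eventually (\<lambda>y. f y = h y) (nhds x)"
  shows "partial_deriv i f x = partial_deriv i h x"
  using frechet_derivative_cong_eventually[OF assms] by (simp add: partial_deriv_def)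

text \<open>Chain rule for a second-order operator in divergence form. Since
  \<open>partial_deriv i w\<close> is \<open>deriv h (u y)\<close> times
  \<open>partial_deriv i u\<close>, one product rule separates the terms with \<open>deriv h\<close>
  from those with \<open>deriv (deriv h)\<close>. The coefficients \<open>a i j\<close> will be the
  inverse metric times the root of its determinant.\<close>

lemma divergence_form_compose:
  fixes u :: "real^'n::finite \<Rightarrow> complex" and a :: "'n \<Rightarrow> 'n \<Rightarrow> real^'n \<Rightarrow> complex"
  assumes S: "open S" "x \<in> S" "smooth_on u S"
    and h: "h holomorphic_on V" "open V" "u ` S \<subseteq> V"
    and a: "\<And>i j. a i j differentiable (at x)"
    and w: "\<And>y. y \<in> S \<Longrightarrow> w y = h (u y)"
  shows "(\<Sum>i\<in>UNIV. \<Sum>j\<in>UNIV. partial_deriv j (\<lambda>y. a i j y * partial_deriv i w y) x)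
    = deriv h (u x) * (\<Sum>i\<in>UNIV. \<Sum>j\<in>UNIV. partial_deriv j (\<lambda>y. a i j y * partial_deriv i u y) x)
      + deriv (deriv h) (u x)
        * (\<Sum>i\<in>UNIV. \<Sum>j\<in>UNIV. a i j x * partial_deriv j u x * partial_deriv i u x)"
proof -
  have dh: "deriv h holomorphic_on V"
    using h by (simp add: holomorphic_deriv)
  have dw: "partial_deriv i w y = deriv h (u y) * partial_deriv i u y" if "y \<in> S" for i y
  proof -
    have "partial_deriv i w y = partial_deriv i (\<lambda>y. h (u y)) y"
      using S w that
      by (intro partial_deriv_cong_eventually eventually_nhds_in_open[THEN eventually_mono]) auto
    also have "\<dots> = deriv h (u y) * partial_deriv i u y"
      unfolding partial_deriv_def using S h that
      by (intro frechet_derivative_field_compose smooth_on_differentiable[of u S])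
        (auto intro: holomorphic_derivI)
    finally show ?thesis .
  qed
  have ux: "u differentiable (at x)"
    using S by (blast intro: smooth_on_differentiable)
  have h'': "(deriv h has_field_derivative deriv (deriv h) (u x)) (at (u x))"
    using S h dh by (auto intro: holomorphic_derivI)
  then have d1: "(\<lambda>y. deriv h (u y)) differentiable (at x)"
    using has_derivative_field_compose[OF h'' ux] by (auto simp: differentiable_def)
  have d2: "(\<lambda>y. a i j y * partial_deriv i u y) differentiable (at x)" for i j
    unfolding partial_deriv_def
    by (intro differentiable_mult a smooth_on_differentiable[OF smooth_on_frechet_derivative[OF S(3)] S(2)])
  have "partial_deriv j (\<lambda>y. a i j y * partial_deriv i w y) x
      = deriv h (u x) * partial_deriv j (\<lambda>y. a i j y * partial_deriv i u y) x
        + deriv (deriv h) (u x) * (a i j x * partial_deriv j u x * partial_deriv i u x)" for i j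
  proof -
    \<comment> \<open>The formula for the gradient of \<open>w\<close> holds on the open set
      \<open>S\<close>, which suffices for a derivative at \<open>x\<close>. The factor
      \<open>deriv h (u y)\<close> is moved to the front, leaving the product differentiated for
      \<open>u\<close> itself.\<close>
    have "partial_deriv j (\<lambda>y. a i j y * partial_deriv i w y) x
        = partial_deriv j (\<lambda>y. deriv h (u y) * (a i j y * partial_deriv i u y)) x"
      using S dw
      by (intro partial_deriv_cong_eventually eventually_nhds_in_open[THEN eventually_mono]) auto
    also have "\<dots> = deriv h (u x) * partial_deriv j (\<lambda>y. a i j y * partial_deriv i u y) x
        + deriv (deriv h) (u x) * partial_deriv j u x * (a i j x * partial_deriv i u x)"
      unfolding partial_deriv_def
      using frechet_derivative_mult[OF d1 d2[unfolded partial_deriv_def]]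
        frechet_derivative_field_compose[OF h'' ux]
      by simp
    finally show ?thesis
      by (simp add: mult_ac)
  qed
  then show ?thesis
    by (simp add: sum.distrib sum_distrib_left)
qed

section \<open>Differentiability of determinants and inverse matrices\<close>

lemma differentiable_prod:
  fixes f :: "'i \<Rightarrow> 'e::real_normed_vector \<Rightarrow> 'b::real_normed_field"
  assumes "\<And>i. i \<in> I \<Longrightarrow> f i differentiable (at x)"
  shows "(\<lambda>y. \<Prod>i\<in>I. f i y) differentiable (at x)"
  using assms by (induction I rule: infinite_finite_induct) (auto intro: differentiable_mult)

lemma differentiable_det:
  fixes M :: "'e::real_normed_vector \<Rightarrow> real^'n^'n"
  assumes "\<And>i j. (\<lambda>y. M y $ i $ j) differentiable (at x)"
  shows "(\<lambda>y. det (M y)) differentiable (at x)"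
  unfolding det_def using assms
  by (intro differentiable_sum ballI differentiable_mult differentiable_prod differentiable_const) auto

lemma matrix_inv_mult:
  assumes "det (M :: real^'n^'n) \<noteq> 0"
  shows "M ** matrix_inv M = mat 1"
  using assms someI_ex[of "\<lambda>B. M ** B = mat 1 \<and> B ** M = mat 1"]
  by (simp add: invertible_det_nz[symmetric] invertible_def matrix_inv_def)

text \<open>Column \<open>l\<close> of the inverse solves the linear system with right-hand side
  \<open>axis l 1\<close>. Cramer's rule writes its entries as quotients of determinants, so
  differentiating the inverse reduces to differentiating determinants.\<close>

lemma matrix_inv_cramer:
  assumes "det (M :: real^'n^'n) \<noteq> 0"
  shows "matrix_inv M $ k $ l = det (\<chi> i j. if j = k then axis l 1 $ i else M $ i $ j) / det M"
proof -
  have "M *v (matrix_inv M *v axis l 1) = axis l 1"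
    using matrix_inv_mult[OF assms] by (simp add: matrix_vector_mul_assoc)
  then have "matrix_inv M *v axis l 1
      = (\<chi> k. det (\<chi> i j. if j = k then axis l 1 $ i else M $ i $ j) / det M)"
    by (simp add: cramer[OF assms])
  moreover have "(matrix_inv M *v axis l 1) $ k = matrix_inv M $ k $ l"
    by (simp add: matrix_vector_mult_basis column_def)
  ultimately show ?thesis
    by simp
qed

lemma differentiable_sqrt_det:
  fixes M :: "'e::real_normed_vector \<Rightarrow> real^'n^'n"
  assumes "\<And>i j. (\<lambda>y. M y $ i $ j) differentiable (at x)" "det (M x) \<noteq> 0"
  shows "(\<lambda>y. sqrt (det (M y))) differentiable (at x)"
proof -
  \<comment> \<open>The real \<open>sqrt\<close> is extended to negative arguments as an odd
    function, hence differentiable away from 0; the derivative is given separately for the two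
    signs.\<close>
  have "sqrt differentiable (at (det (M x)))"
    using DERIV_real_sqrt_generic[OF assms(2),
        of "if det (M x) > 0 then inverse (sqrt (det (M x))) / 2 else - inverse (sqrt (det (M x))) / 2"]
    by (auto simp: real_differentiable_def)
  then show ?thesis
    using differentiable_chain_at[OF differentiable_det[OF assms(1)]] by (auto simp: o_def)
qed

lemma differentiable_matrix_inv:
  fixes M :: "'e::real_normed_vector \<Rightarrow> real^'n^'n"
  assumes S: "open S" "x \<in> S" "\<And>y. y \<in> S \<Longrightarrow> det (M y) \<noteq> 0"
    and M: "\<And>i j. (\<lambda>y. M y $ i $ j) differentiable (at x)"
  shows "(\<lambda>y. matrix_inv (M y) $ k $ l) differentiable (at x)"
proof (rule differentiable_cong_open[OF _ S(1,2)])
  have "(\<lambda>y. (\<chi> i j. if j = k then axis l 1 $ i else M y $ i $ j) $ i $ j) differentiable (at x)" for i j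
    using M by (cases "j = k") auto
  then show "(\<lambda>y. det (\<chi> i j. if j = k then axis l 1 $ i else M y $ i $ j) / det (M y))
      differentiable (at x)"
    using S M by (intro differentiable_divide differentiable_det) auto
qed (simp add: matrix_inv_cramer S(3))

text \<open>Lowering the index of the gradient with \<open>g\<close> returns the differential, so
  the metric on two gradients is the differential evaluated on the gradient.\<close>

lemma metric_bilinear_gradient:
  assumes "det (g \<kappa> p) \<noteq> 0"
  shows "metric_bilinear g \<kappa> p (gradient_in g \<kappa> \<phi> p) (gradient_in g \<kappa> \<phi> p)
    = (\<Sum>i\<in>UNIV. \<Sum>j\<in>UNIV. of_real (matrix_inv (g \<kappa> p) $ i $ j)
        * partial_deriv j (\<phi> \<circ> chart_inv \<kappa>) (snd \<kappa> p) * partial_deriv i (\<phi> \<circ> chart_inv \<kappa>) (snd \<kappa> p))"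
    (is "_ = (\<Sum>i\<in>UNIV. \<Sum>j\<in>UNIV. _ * ?d j * ?d i)")
proof -
  define v where "v = gradient_in g \<kappa> \<phi> p"
  have v: "v $ j = (\<Sum>k\<in>UNIV. of_real (matrix_inv (g \<kappa> p) $ j $ k) * ?d k)" for j
    by (simp add: v_def gradient_in_def)
  have inv: "(\<Sum>j\<in>UNIV. g \<kappa> p $ i $ j * matrix_inv (g \<kappa> p) $ j $ k) = (if i = k then 1 else 0)" for i k
    using matrix_inv_mult[OF assms] by (simp add: vec_eq_iff matrix_matrix_mult_def mat_def)
  have lower: "(\<Sum>j\<in>UNIV. of_real (g \<kappa> p $ i $ j) * v $ j) = ?d i" for i
  proof -
    have "(\<Sum>j\<in>UNIV. of_real (g \<kappa> p $ i $ j) * v $ j)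
        = (\<Sum>k\<in>UNIV. \<Sum>j\<in>UNIV. of_real (g \<kappa> p $ i $ j * matrix_inv (g \<kappa> p) $ j $ k) * ?d k)"
      unfolding v sum_distrib_left by (subst sum.swap) (simp add: mult_ac)
    also have "\<dots> = (\<Sum>k\<in>UNIV. of_real (if i = k then 1 else 0) * ?d k)"
      by (simp add: inv[symmetric] sum_distrib_right)
    also have "\<dots> = (\<Sum>k\<in>UNIV. if i = k then ?d k else 0)"
      by (intro sum.cong) auto
    finally show ?thesis
      by simp
  qed
  have "metric_bilinear g \<kappa> p v v = (\<Sum>i\<in>UNIV. v $ i * (\<Sum>j\<in>UNIV. of_real (g \<kappa> p $ i $ j) * v $ j))"
    by (simp add: metric_bilinear_def sum_distrib_left mult_ac)
  also have "\<dots> = (\<Sum>i\<in>UNIV. v $ i * ?d i)"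
    by (simp only: lower)
  finally show ?thesis
    by (simp add: v sum_distrib_right flip: v_def)
qed


section \<open>Compositions on a Riemannian manifold\<close>

context riemannian_manifold
begin

section \<open>Charts and the nondegeneracy of the metric\<close>

lemma chart_at:
  assumes "p \<in> topspace X"
  shows "chart_at A p \<in> A" "p \<in> fst (chart_at A p)"
proof -
  have "\<exists>\<kappa>. \<kappa> \<in> A \<and> p \<in> fst \<kappa>"
    using assms charts_cover by blast
  then show "chart_at A p \<in> A" "p \<in> fst (chart_at A p)"
    unfolding chart_at_def by (metis (mono_tags, lifting) someI_ex)+
qed

lemma chart_domain_subset: "\<kappa> \<in> A \<Longrightarrow> fst \<kappa> \<subseteq> topspace X"
  using charts_cover by blast

lemma chart_inv_in: "x \<in> snd \<kappa> ` fst \<kappa> \<Longrightarrow> chart_inv \<kappa> x \<in> fst \<kappa>"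
  by (simp add: chart_inv_def inv_into_into)

lemma chart_inv_left:
  assumes "\<kappa> \<in> A" "p \<in> fst \<kappa>"
  shows "chart_inv \<kappa> (snd \<kappa> p) = p"
proof -
  have "inj_on (snd \<kappa>) (fst \<kappa>)"
    using homeomorphic_imp_injective_map[OF chart_homeomorphic[OF assms(1)]]
      chart_domain_subset[OF assms(1)]
    by (simp add: inf_absorb2)
  then show ?thesis
    using assms by (simp add: chart_inv_def)
qed

text \<open>Positive definiteness forces the kernel of the metric matrix to be trivial.\<close>

lemma det_metric_nonzero:
  assumes "\<kappa> \<in> A" "p \<in> fst \<kappa>"
  shows "det (g \<kappa> p) \<noteq> 0"
proof -
  have "\<forall>v. g \<kappa> p *v v = 0 \<longrightarrow> v = 0"
    using metric_pos_def[OF assms] by fastforce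
  then have "invertible (g \<kappa> p)"
    using matrix_left_invertible_ker[of "g \<kappa> p"] by (simp add: invertible_left_inverse)
  then show ?thesis
    by (simp add: invertible_det_nz)
qed

section \<open>Coordinate expressions and preimages of open sets\<close>

lemma smooth_in_chart:
  assumes "smooth_fun_on A \<phi> (topspace X)" "\<kappa> \<in> A"
  shows "smooth_on (\<phi> \<circ> chart_inv \<kappa>) (snd \<kappa> ` fst \<kappa>)"
  using assms chart_domain_subset[OF assms(2)] by (auto simp: smooth_fun_on_def inf_absorb1)

text \<open>Turns the coordinate image of a preimage into a preimage under the coordinate
  expression, whose continuity then yields openness.\<close>

lemma chart_image_preimage:
  assumes "\<kappa> \<in> A"
  shows "snd \<kappa> ` (fst \<kappa> \<inter> {p \<in> topspace X. \<phi> p \<in> V})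
    = snd \<kappa> ` fst \<kappa> \<inter> (\<phi> \<circ> chart_inv \<kappa>) -` V"
  using chart_inv_left[OF assms] chart_domain_subset[OF assms]
  by (auto simp: image_iff)

lemma open_chart_image_preimage:
  assumes "smooth_fun_on A \<phi> (topspace X)" "\<kappa> \<in> A" "open V"
  shows "open (snd \<kappa> ` (fst \<kappa> \<inter> {p \<in> topspace X. \<phi> p \<in> V}))"
  unfolding chart_image_preimage[OF assms(2)]
  using smooth_on_continuous[OF smooth_in_chart[OF assms(1,2)]] chart_image_open[OF assms(2)] assms(3)
  by (intro continuous_open_preimage)

text \<open>\<open>smooth_fun_on\<close> speaks of coordinate expressions only, so openness is shown
  inside each chart domain by pulling back an open set of coordinates; the chart domains are open
  and cover \<open>X\<close>.\<close>

lemma openin_preimage: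
  assumes "smooth_fun_on A \<phi> (topspace X)" "open V"
  shows "openin X {p \<in> topspace X. \<phi> p \<in> V}"
proof -
  have "openin X (fst \<kappa> \<inter> {p \<in> topspace X. \<phi> p \<in> V})" if "\<kappa> \<in> A" for \<kappa>
  proof -
    let ?T = "snd \<kappa> ` (fst \<kappa> \<inter> {p \<in> topspace X. \<phi> p \<in> V})"
    have "continuous_map (subtopology X (fst \<kappa>)) (top_of_set (snd \<kappa> ` fst \<kappa>)) (snd \<kappa>)"
      using chart_homeomorphic[OF that] homeomorphic_imp_continuous_map by blast
    moreover have "openin (top_of_set (snd \<kappa> ` fst \<kappa>)) ?T"
      using open_chart_image_preimage[OF assms(1) that assms(2)] by (intro open_subset) auto
    ultimately have "openin (subtopology X (fst \<kappa>))
        {p \<in> topspace (subtopology X (fst \<kappa>)). snd \<kappa> p \<in> ?T}"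
      by (rule openin_continuous_map_preimage)
    moreover have "{p \<in> topspace (subtopology X (fst \<kappa>)). snd \<kappa> p \<in> ?T}
        = fst \<kappa> \<inter> {p \<in> topspace X. \<phi> p \<in> V}"
      using chart_inv_left[OF that] chart_domain_subset[OF that] by (auto simp: image_iff) metis
    ultimately show ?thesis
      using openin_trans_full[OF _ chart_domain_open[OF that]] by metis
  qed
  then have "openin X (\<Union>\<kappa>\<in>A. fst \<kappa> \<inter> {p \<in> topspace X. \<phi> p \<in> V})"
    by blast
  moreover have "(\<Union>\<kappa>\<in>A. fst \<kappa> \<inter> {p \<in> topspace X. \<phi> p \<in> V}) = {p \<in> topspace X. \<phi> p \<in> V}"
    using charts_cover by blast
  ultimately show ?thesis
    by simp
qed

lemma smooth_fun_on_compose: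
  assumes "smooth_fun_on A \<phi> (topspace X)" "open V" "h holomorphic_on V"
  shows "smooth_fun_on A (h \<circ> \<phi>) {p \<in> topspace X. \<phi> p \<in> V}"
  unfolding smooth_fun_on_def smooth_on_def
proof (intro ballI allI)
  fix \<kappa> k
  assume \<kappa>: "\<kappa> \<in> A"
  let ?T = "snd \<kappa> ` (fst \<kappa> \<inter> {p \<in> topspace X. \<phi> p \<in> V})"
  have "Ck_on k (\<phi> \<circ> chart_inv \<kappa>) ?T"
    using smooth_in_chart[OF assms(1) \<kappa>] unfolding smooth_on_def by (blast intro: Ck_on_subset)
  then have "Ck_on k (\<lambda>x. h ((\<phi> \<circ> chart_inv \<kappa>) x)) ?T"
    by (rule Ck_on_holomorphic_compose[OF _ open_chart_image_preimage[OF assms(1) \<kappa> assms(2)] assms(3,2)])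
      (use chart_inv_left[OF \<kappa>] in auto)
  then show "Ck_on k (h \<circ> \<phi> \<circ> chart_inv \<kappa>) ?T"
    by (simp add: o_def)
qed

section \<open>Differential operators on compositions\<close>

text \<open>All terms are evaluated in the one chart \<open>chart_at A p\<close>, where
  \<open>divergence_form_compose\<close> applies. Agreement of \<psi> with the composition is asked
  only over \<open>V\<close>, so that \<psi> may be an iterate of \<open>tension\<close>, whose
  values are known only there.\<close>

lemma tension_compose:
  assumes \<phi>: "smooth_fun_on A \<phi> (topspace X)" and V: "open V" and h: "h holomorphic_on V"
    and p: "p \<in> topspace X" "\<phi> p \<in> V"
    and \<psi>: "\<And>q. q \<in> topspace X \<Longrightarrow> \<phi> q \<in> V \<Longrightarrow> \<psi> q = h (\<phi> q)"
  shows "tension A g \<psi> p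
    = deriv h (\<phi> p) * tension A g \<phi> p + deriv (deriv h) (\<phi> p) * conformality A g \<phi> \<phi> p"
proof -
  define \<kappa> where "\<kappa> = chart_at A p"
  have \<kappa>: "\<kappa> \<in> A" "p \<in> fst \<kappa>"
    using chart_at[OF p(1)] by (simp_all add: \<kappa>_def)
  define S where "S = snd \<kappa> ` (fst \<kappa> \<inter> {p \<in> topspace X. \<phi> p \<in> V})"
  define u where "u = \<phi> \<circ> chart_inv \<kappa>"
  define x where "x = snd \<kappa> p"
  define G where "G = (\<lambda>y. g \<kappa> (chart_inv \<kappa> y))"
  define s where "s = complex_of_real (sqrt (det (G x)))"
  have S: "open S" "x \<in> S" "S \<subseteq> snd \<kappa> ` fst \<kappa>" "u ` S \<subseteq> V"
    using open_chart_image_preimage[OF \<phi> \<kappa>(1) V] \<kappa> p chart_inv_left[OF \<kappa>(1)]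
    by (auto simp: S_def x_def u_def)
  have Gx: "G x = g \<kappa> p" and ux: "u x = \<phi> p"
    by (simp_all add: G_def u_def x_def chart_inv_left \<kappa>)
  have u: "smooth_on u S"
    using smooth_in_chart[OF \<phi> \<kappa>(1)] S(3)
    unfolding smooth_on_def u_def by (blast intro: Ck_on_subset)
  have detG: "det (G y) \<noteq> 0" if "y \<in> S" for y
    using det_metric_nonzero[OF \<kappa>(1) chart_inv_in[of y \<kappa>]] S(3) that by (auto simp: G_def)
  have G: "(\<lambda>y. G y $ i $ j) differentiable (at x)" for i j
    using smooth_on_differentiable[OF metric_smooth[OF \<kappa>(1)]] S(2,3) unfolding G_def by blast
  define a where "a = (\<lambda>i j y. complex_of_real (matrix_inv (G y) $ i $ j * sqrt (det (G y))))"
  have a: "a i j differentiable (at x)" for i j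
  proof -
    have "(\<lambda>y. matrix_inv (G y) $ i $ j * sqrt (det (G y))) differentiable (at x)"
      by (intro differentiable_mult differentiable_matrix_inv[OF S(1,2) detG]
          differentiable_sqrt_det G detG S(2))
    then show ?thesis
      unfolding a_def using differentiable_chain_at[OF _ of_real_differentiable] unfolding o_def by blast
  qed
  have \<psi>u: "(\<psi> \<circ> chart_inv \<kappa>) y = h (u y)" if "y \<in> S" for y
    using that chart_inv_left[OF \<kappa>(1)] by (auto simp: S_def u_def intro!: \<psi>)
  have s: "s \<noteq> 0"
    using detG[OF S(2)] by (simp add: s_def)
  have T: "tension A g f p
      = 1 / s * (\<Sum>i\<in>UNIV. \<Sum>j\<in>UNIV. partial_deriv j (\<lambda>y. a i j y * partial_deriv i (f \<circ> chart_inv \<kappa>) y) x)"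
    for f
    by (simp add: tension_def tension_in_def \<kappa>_def x_def Let_def a_def G_def s_def)
  have C: "conformality A g \<phi> \<phi> p
      = 1 / s * (\<Sum>i\<in>UNIV. \<Sum>j\<in>UNIV. a i j x * partial_deriv j u x * partial_deriv i u x)"
  proof -
    \<comment> \<open>The coefficients of the divergence form carry the factor \<open>s\<close>; the
      prefactor \<open>1 / s\<close> of the operator cancels it, so the second-order sum is exactly
      the conformality operator.\<close>
    have "a i j x = s * of_real (matrix_inv (g \<kappa> p) $ i $ j)" for i j
      by (simp add: a_def s_def Gx)
    then have "(\<Sum>i\<in>UNIV. \<Sum>j\<in>UNIV. a i j x * partial_deriv j u x * partial_deriv i u x)
        = s * metric_bilinear g \<kappa> p (gradient_in g \<kappa> \<phi> p) (gradient_in g \<kappa> \<phi> p)"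
      by (simp add: metric_bilinear_gradient[of g \<kappa> p \<phi>, OF det_metric_nonzero[OF \<kappa>]]
          u_def x_def sum_distrib_left mult.assoc)
    then show ?thesis
      using s by (simp add: conformality_def \<kappa>_def Let_def)
  qed
  show ?thesis
    unfolding T C
    using divergence_form_compose[where w = "\<psi> \<circ> chart_inv \<kappa>" and a = a, OF S(1,2) u h V S(4) a \<psi>u]
    by (simp add: ux flip: u_def) (simp add: add_divide_distrib)
qed

text \<open>Differentiating the constant composition gives \<open>deriv h (\<phi> p)\<close> times
  each partial derivative of \<phi>; as the first factor is nonzero, the gradient of \<phi> vanishes
  at \<open>p\<close>.\<close>

lemma conformality_eq_0_if_compose_constant:
  assumes \<phi>: "smooth_fun_on A \<phi> (topspace X)" and V: "open V" and h: "h holomorphic_on V"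
    and p: "p \<in> topspace X" "\<phi> p \<in> V"
    and const: "\<And>q. q \<in> topspace X \<Longrightarrow> \<phi> q \<in> V \<Longrightarrow> h (\<phi> q) = c"
    and h': "deriv h (\<phi> p) \<noteq> 0"
  shows "conformality A g \<phi> \<phi> p = 0"
proof -
  define \<kappa> where "\<kappa> = chart_at A p"
  have \<kappa>: "\<kappa> \<in> A" "p \<in> fst \<kappa>"
    using chart_at[OF p(1)] by (simp_all add: \<kappa>_def)
  define S where "S = snd \<kappa> ` (fst \<kappa> \<inter> {p \<in> topspace X. \<phi> p \<in> V})"
  define u where "u = \<phi> \<circ> chart_inv \<kappa>"
  define x where "x = snd \<kappa> p"
  have S: "open S" "x \<in> S"
    using open_chart_image_preimage[OF \<phi> \<kappa>(1) V] \<kappa> p by (auto simp: S_def x_def)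
  have ux: "u x = \<phi> p"
    by (simp add: u_def x_def chart_inv_left \<kappa>)
  have du: "u differentiable (at x)"
    using smooth_on_differentiable[OF smooth_in_chart[OF \<phi> \<kappa>(1)]] \<kappa>(2) unfolding u_def x_def by blast
  have "partial_deriv i u x = 0" for i
  proof -
    have "h (u y) = c" if "y \<in> S" for y
      using that chart_inv_left[OF \<kappa>(1)] by (auto simp: S_def u_def intro!: const)
    then have "partial_deriv i (\<lambda>y. h (u y)) x = partial_deriv i (\<lambda>y. c) x"
      using S by (intro partial_deriv_cong_eventually eventually_nhds_in_open[THEN eventually_mono]) auto
    moreover have "partial_deriv i (\<lambda>y. h (u y)) x = deriv h (u x) * partial_deriv i u x"
      unfolding partial_deriv_def
      using h V p du by (intro frechet_derivative_field_compose) (auto simp: ux intro: holomorphic_derivI)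
    ultimately show ?thesis
      using h' by (simp add: partial_deriv_def ux)
  qed
  then show ?thesis
    by (simp add: conformality_def metric_bilinear_def gradient_in_def Let_def
        flip: \<kappa>_def x_def u_def)
qed

end

section \<open>The two families of functions\<close>

lemma antiderivative_on_holomorphic:
  assumes "antiderivative_on V h H" "open V"
  shows "H holomorphic_on V"
  using assms by (auto simp: antiderivative_on_def holomorphic_on_open)

lemma antiderivative_on_deriv:
  assumes "antiderivative_on V h H" "z \<in> V"
  shows "deriv H z = h z"
  using assms by (auto simp: antiderivative_on_def intro: DERIV_imp_deriv)

lemma deriv_eq_on_open:
  assumes "open V" "z \<in> V" "\<And>y. y \<in> V \<Longrightarrow> f y = h y"
  shows "deriv f z = deriv h z"
  using assms by (intro deriv_cong_ev eventually_nhds_in_open[THEN eventually_mono]) auto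

section \<open>Iterated tension fields of powers and of recursive chains\<close>

context riemannian_manifold
begin

text \<open>With zero conformality and the normalisation of \<open>deriv F\<close>, each application
  lowers the exponent by one and multiplies by the old exponent. Both \<open>c\<close> and \<psi>
  vary in the induction: the constant absorbs these factors, and the tension field of \<psi> is a
  power of \<open>F\<close> only over \<open>V\<close>.\<close>

lemma tension_funpow_power:
  assumes \<phi>: "smooth_fun_on A \<phi> (topspace X)" and V: "open V"
    and F: "F holomorphic_on V" "\<And>p. p \<in> topspace X \<Longrightarrow> \<phi> p \<in> V \<Longrightarrow> deriv F (\<phi> p) * tension A g \<phi> p = 1"
    and \<kappa>: "\<And>p. p \<in> topspace X \<Longrightarrow> \<phi> p \<in> V \<Longrightarrow> conformality A g \<phi> \<phi> p = 0"
    and \<psi>: "\<And>p. p \<in> topspace X \<Longrightarrow> \<phi> p \<in> V \<Longrightarrow> \<psi> p = c * F (\<phi> p) ^ m"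
    and p: "p \<in> topspace X" "\<phi> p \<in> V"
  shows "(tension A g ^^ m) \<psi> p = c * fact m"
  using \<psi> p
proof (induction m arbitrary: \<psi> c p)
  case 0
  then show ?case
    by simp
next
  case (Suc m)
  have "tension A g \<psi> q = c * of_nat (Suc m) * F (\<phi> q) ^ m" if q: "q \<in> topspace X" "\<phi> q \<in> V" for q
  proof -
    have "((\<lambda>z. c * F z ^ Suc m) has_field_derivative c * (of_nat (Suc m) * F (\<phi> q) ^ m * deriv F (\<phi> q))) (at (\<phi> q))"
      using DERIV_power[OF holomorphic_derivI[OF F(1) V q(2)], of "Suc m"]
      by (intro DERIV_cmult) (simp add: mult_ac)
    then have "deriv (\<lambda>z. c * F z ^ Suc m) (\<phi> q) = c * (of_nat (Suc m) * F (\<phi> q) ^ m * deriv F (\<phi> q))"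
      by (rule DERIV_imp_deriv)
    moreover have "tension A g \<psi> q = deriv (\<lambda>z. c * F z ^ Suc m) (\<phi> q) * tension A g \<phi> q"
      using tension_compose[where h = "\<lambda>z. c * F z ^ Suc m" and \<psi> = \<psi>, OF \<phi> V _ q Suc.prems(1)] F(1) \<kappa>[OF q]
      by (simp add: holomorphic_intros)
    ultimately show ?thesis
      using F(2)[OF q] by (simp only: mult.assoc mult_1_right)
  qed
  \<comment> \<open>The induction hypothesis is used with \<open>tension A g \<psi>\<close> for the
    function, so the innermost application is split off; \<open>funpow_swap1\<close> reconciles this
    with the outermost one.\<close>
  then have "(tension A g ^^ m) (tension A g \<psi>) p = c * of_nat (Suc m) * fact m"
    using Suc.prems(2,3) by (rule Suc.IH)
  then show ?case
    by (simp add: funpow_swap1 algebra_simps)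
qed

lemma tension_compose_constant:
  assumes "smooth_fun_on A \<phi> (topspace X)" "open V" "p \<in> topspace X" "\<phi> p \<in> V"
    and "\<And>q. q \<in> topspace X \<Longrightarrow> \<phi> q \<in> V \<Longrightarrow> \<psi> q = c"
  shows "tension A g \<psi> p = 0"
  using tension_compose[where h = "\<lambda>_. c" and \<psi> = \<psi>, OF assms(1,2) holomorphic_on_const assms(3,4)] assms(5) by simp

text \<open>Iterate \<open>m\<close> is the constant \<open>c * fact m\<close>, nonzero and taken on
  a nonempty set, which gives properness; one more application annihilates a constant.\<close>

lemma proper_r_harmonic_on_power:
  assumes \<phi>: "smooth_fun_on A \<phi> (topspace X)" and V: "open V" "{p \<in> topspace X. \<phi> p \<in> V} \<noteq> {}"
    and F: "F holomorphic_on V" "\<And>p. p \<in> topspace X \<Longrightarrow> \<phi> p \<in> V \<Longrightarrow> deriv F (\<phi> p) * tension A g \<phi> p = 1"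
    and \<kappa>: "\<And>p. p \<in> topspace X \<Longrightarrow> \<phi> p \<in> V \<Longrightarrow> conformality A g \<phi> \<phi> p = 0"
    and f: "\<And>z. z \<in> V \<Longrightarrow> f z = c * F z ^ m" and c: "c \<noteq> 0"
  shows "proper_r_harmonic_on X A g (Suc m) (f \<circ> \<phi>) {p \<in> topspace X. \<phi> p \<in> V}"
proof -
  have "(\<lambda>z. c * F z ^ m) holomorphic_on V"
    using F(1) by (intro holomorphic_intros)
  then have "f holomorphic_on V"
    by (rule holomorphic_transform) (simp add: f)
  moreover have iter: "(tension A g ^^ m) (f \<circ> \<phi>) p = c * fact m"
    if "p \<in> topspace X" "\<phi> p \<in> V" for p
    using f that by (intro tension_funpow_power[OF \<phi> V(1) F \<kappa>]) auto
  moreover have "(tension A g ^^ Suc m) (f \<circ> \<phi>) p = 0" if "p \<in> topspace X" "\<phi> p \<in> V" for p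
    using tension_compose_constant[OF \<phi> V(1) that iter] by simp
  ultimately show ?thesis
    using V \<phi> c unfolding proper_r_harmonic_on_def
    by (auto simp: openin_preimage smooth_fun_on_compose simp del: funpow.simps)
qed

text \<open>By \<open>step\<close>, the tension field sends each composition to the preceding member
  of the family, so \<open>m\<close> applications descend from index \<open>m\<close> to index
  0.\<close>

lemma tension_funpow_chain:
  assumes \<phi>: "smooth_fun_on A \<phi> (topspace X)" and V: "open V"
    and f: "\<And>k. f k holomorphic_on V"
    and step: "\<And>k p. p \<in> topspace X \<Longrightarrow> \<phi> p \<in> V \<Longrightarrow>
      deriv (f (Suc k)) (\<phi> p) * tension A g \<phi> p
        + deriv (deriv (f (Suc k))) (\<phi> p) * conformality A g \<phi> \<phi> p = f k (\<phi> p)"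
    and \<psi>: "\<And>p. p \<in> topspace X \<Longrightarrow> \<phi> p \<in> V \<Longrightarrow> \<psi> p = f m (\<phi> p)"
    and p: "p \<in> topspace X" "\<phi> p \<in> V"
  shows "(tension A g ^^ m) \<psi> p = f 0 (\<phi> p)"
  using \<psi> p
proof (induction m arbitrary: \<psi> p)
  case 0
  then show ?case
    by simp
next
  case (Suc m)
  have "tension A g \<psi> q = f m (\<phi> q)" if "q \<in> topspace X" "\<phi> q \<in> V" for q
    using tension_compose[where h = "f (Suc m)" and \<psi> = \<psi>, OF \<phi> V f that Suc.prems(1)] step[OF that] by simp
  then have "(tension A g ^^ m) (tension A g \<psi>) p = f 0 (\<phi> p)"
    using Suc.prems(2,3) by (rule Suc.IH)
  then show ?case
    by (simp add: funpow_swap1)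
qed

text \<open>Iterate \<open>m\<close> is the composition with \<open>f 0\<close>:
  \<open>nonzero\<close> makes this proper and \<open>base\<close> kills it at the next application.
  Indices start at 0, so member \<open>m\<close> has order \<open>Suc m\<close>.\<close>

lemma proper_r_harmonic_on_chain:
  assumes \<phi>: "smooth_fun_on A \<phi> (topspace X)" and V: "open V"
    and f: "\<And>k. f k holomorphic_on V"
    and step: "\<And>k p. p \<in> topspace X \<Longrightarrow> \<phi> p \<in> V \<Longrightarrow>
      deriv (f (Suc k)) (\<phi> p) * tension A g \<phi> p
        + deriv (deriv (f (Suc k))) (\<phi> p) * conformality A g \<phi> \<phi> p = f k (\<phi> p)"
    and base: "\<And>p. p \<in> topspace X \<Longrightarrow> \<phi> p \<in> V \<Longrightarrow>
      deriv (f 0) (\<phi> p) * tension A g \<phi> p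
        + deriv (deriv (f 0)) (\<phi> p) * conformality A g \<phi> \<phi> p = 0"
    and nonzero: "\<not> (\<forall>p\<in>{p \<in> topspace X. \<phi> p \<in> V}. f 0 (\<phi> p) = 0)"
  shows "proper_r_harmonic_on X A g (Suc m) (f m \<circ> \<phi>) {p \<in> topspace X. \<phi> p \<in> V}"
proof -
  have iter: "(tension A g ^^ m) (f m \<circ> \<phi>) p = f 0 (\<phi> p)"
    if "p \<in> topspace X" "\<phi> p \<in> V" for p
    using that by (intro tension_funpow_chain[where f = f, OF \<phi> V f step]) auto
  moreover have "(tension A g ^^ Suc m) (f m \<circ> \<phi>) p = 0" if "p \<in> topspace X" "\<phi> p \<in> V" for p
    using tension_compose[where h = "f 0", OF \<phi> V f that iter] base[OF that] by simp
  ultimately show ?thesis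
    using V \<phi> f nonzero unfolding proper_r_harmonic_on_def
    by (auto simp: openin_preimage smooth_fun_on_compose simp del: funpow.simps)
qed

end

text \<open>\<open>V\<close> is the domain of the functions \<open>f r\<close>. Its preimage is
  taken nonempty because on the empty set every iterate vanishes and nothing is proper.
  Antiderivatives are existentially quantified: \<open>F\<close> in the first case and
  \<open>H\<close> in the second may be chosen anew for each \<open>r\<close>, so all integration
  constants are covered.\<close>

theorem theorem3p4:
  fixes X :: "'a topology" and A :: "('a, 'n::finite) chart set" and g :: "('a, 'n) metric"
    and \<phi> :: "'a \<Rightarrow> complex" and U V :: "complex set" and \<Phi> \<Psi> :: "complex \<Rightarrow> complex"
    and f :: "nat \<Rightarrow> complex \<Rightarrow> complex"
  assumes "riemannian_manifold X A g"
    and "complex_isoparametric X A g \<phi>"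
    and "open U" and "\<phi> ` topspace X \<subseteq> U"
    and "\<Phi> holomorphic_on U" and "\<Psi> holomorphic_on U"
    and "\<forall>p\<in>topspace X. tension A g \<phi> p = \<Phi> (\<phi> p)"
    and "\<forall>p\<in>topspace X. conformality A g \<phi> \<phi> p = \<Psi> (\<phi> p)"
    and "open V" and "simply_connected V"
    and "{p \<in> topspace X. \<phi> p \<in> V} \<noteq> {}"
    and "((\<forall>z\<in>U. \<Psi> z = 0) \<and> V \<subseteq> U - \<Phi> -` {0} \<and>
           (\<exists>c. c \<noteq> 0 \<and>
             (\<forall>r\<ge>1. \<exists>F. antiderivative_on V (\<lambda>\<zeta>. 1 / \<Phi> \<zeta>) F \<and>
                          (\<forall>z\<in>V. f r z = c * F z ^ (r - 1)))))
       \<or> ((\<exists>z\<in>U. \<Psi> z \<noteq> 0) \<and> V \<subseteq> U - \<Psi> -` {0} \<and>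
           (\<exists>\<Lambda> L c\<^sub>1 c\<^sub>2.
             antiderivative_on V (\<lambda>\<zeta>. \<Phi> \<zeta> / \<Psi> \<zeta>) L \<and> (\<forall>z\<in>V. \<Lambda> z = exp (- L z)) \<and>
             (c\<^sub>1, c\<^sub>2) \<noteq> (0, 0) \<and>
             (\<exists>F. antiderivative_on V \<Lambda> F \<and> (\<forall>z\<in>V. f 1 z = c\<^sub>1 * F z + c\<^sub>2)) \<and>
             (\<forall>r>1. \<exists>H. antiderivative_on V (\<lambda>\<zeta>. f (r - 1) \<zeta> / (\<Lambda> \<zeta> * \<Psi> \<zeta>)) H \<and>
                          antiderivative_on V (\<lambda>\<eta>. \<Lambda> \<eta> * H \<eta>) (f r))))"
  shows "\<forall>r\<ge>1. proper_r_harmonic_on X A g r (f r \<circ> \<phi>) {p \<in> topspace X. \<phi> p \<in> V}"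
proof -
  interpret riemannian_manifold X A g
    by fact
  have \<phi>: "smooth_fun_on A \<phi> (topspace X)"
    using assms(2) by (simp add: complex_isoparametric_def)
  have \<tau>: "tension A g \<phi> p = \<Phi> (\<phi> p)" and \<kappa>: "conformality A g \<phi> \<phi> p = \<Psi> (\<phi> p)"
    if "p \<in> topspace X" for p
    using assms(7,8) that by auto
  note V = \<open>open V\<close> and ne = \<open>{p \<in> topspace X. \<phi> p \<in> V} \<noteq> {}\<close>
  have "proper_r_harmonic_on X A g (Suc m) (f (Suc m) \<circ> \<phi>) {p \<in> topspace X. \<phi> p \<in> V}" for m
    using assms(12)
  proof (elim disjE conjE exE)
    fix c
    assume \<Psi>0: "\<forall>z\<in>U. \<Psi> z = 0" and VU: "V \<subseteq> U - \<Phi> -` {0}" and c: "c \<noteq> 0"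
      and "\<forall>r\<ge>1. \<exists>F. antiderivative_on V (\<lambda>\<zeta>. 1 / \<Phi> \<zeta>) F \<and> (\<forall>z\<in>V. f r z = c * F z ^ (r - 1))"
    \<comment> \<open>Only the antiderivative belonging to the order \<open>Suc m\<close> is needed,
      since the iterates are computed from powers of this single \<open>F\<close>.\<close>
    then obtain F where F: "antiderivative_on V (\<lambda>\<zeta>. 1 / \<Phi> \<zeta>) F"
      and f: "\<And>z. z \<in> V \<Longrightarrow> f (Suc m) z = c * F z ^ m"
      by (metis One_nat_def Suc_le_mono diff_Suc_1 le0)
    show ?thesis
    proof (rule proper_r_harmonic_on_power[OF \<phi> V ne antiderivative_on_holomorphic[OF F V] _ _ f c])
      show "deriv F (\<phi> p) * tension A g \<phi> p = 1" if "p \<in> topspace X" "\<phi> p \<in> V" for p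
        using that VU by (auto simp: \<tau> antiderivative_on_deriv[OF F])
      show "conformality A g \<phi> \<phi> p = 0" if "p \<in> topspace X" "\<phi> p \<in> V" for p
        using that \<Psi>0 VU by (auto simp: \<kappa>)
    qed
  next
    fix \<Lambda> L c\<^sub>1 c\<^sub>2 F
    assume VU: "V \<subseteq> U - \<Psi> -` {0}" and L: "antiderivative_on V (\<lambda>\<zeta>. \<Phi> \<zeta> / \<Psi> \<zeta>) L"
      and \<Lambda>: "\<forall>z\<in>V. \<Lambda> z = exp (- L z)" and c: "(c\<^sub>1, c\<^sub>2) \<noteq> (0, 0)"
      and F: "antiderivative_on V \<Lambda> F" and f1: "\<forall>z\<in>V. f 1 z = c\<^sub>1 * F z + c\<^sub>2"
      and rec: "\<forall>r>1. \<exists>H. antiderivative_on V (\<lambda>\<zeta>. f (r - 1) \<zeta> / (\<Lambda> \<zeta> * \<Psi> \<zeta>)) H \<and>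
        antiderivative_on V (\<lambda>\<eta>. \<Lambda> \<eta> * H \<eta>) (f r)"
    \<comment> \<open>The integrating factor equation. \<Lambda> is an exponential only on
      \<open>V\<close>, so the derivative is transferred from the exponential by openness.\<close>
    have d\<Lambda>: "(\<Lambda> has_field_derivative - (\<Phi> z / \<Psi> z) * \<Lambda> z) (at z)" if z: "z \<in> V" for z
    proof (rule has_field_derivative_transform_within_open[OF _ V z])
      have "(L has_field_derivative \<Phi> z / \<Psi> z) (at z)"
        using L z by (simp add: antiderivative_on_def)
      then show "((\<lambda>z. exp (- L z)) has_field_derivative - (\<Phi> z / \<Psi> z) * \<Lambda> z) (at z)"
        using \<Lambda> z by (auto intro!: derivative_eq_intros)
    qed (use \<Lambda> in auto)
    \<comment> \<open>A uniform first-order form: the derivative of \<open>f (Suc k)\<close> is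
      \<Lambda> times \<open>h\<close>, where \<open>h\<close> is the inner integral for positive
      \<open>k\<close> and the constant \<open>c\<^sub>1\<close> for \<open>k = 0\<close>. The
      recursion starts at \<open>f 1\<close>, so 0 stands in for the unspecified
      \<open>f 0\<close>.\<close>
    have df: "\<exists>h. (\<forall>z\<in>V. (f (Suc k) has_field_derivative \<Lambda> z * h z) (at z)) \<and>
        (\<forall>z\<in>V. (h has_field_derivative (if k = 0 then 0 else f k z / (\<Lambda> z * \<Psi> z))) (at z)) \<and>
        (k = 0 \<longrightarrow> h = (\<lambda>_. c\<^sub>1))" for k
    proof (cases "k = 0")
      case True
      have "(f 1 has_field_derivative \<Lambda> z * c\<^sub>1) (at z)" if z: "z \<in> V" for z
      proof (rule has_field_derivative_transform_within_open[OF _ V z])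
        show "((\<lambda>z. c\<^sub>1 * F z + c\<^sub>2) has_field_derivative \<Lambda> z * c\<^sub>1) (at z)"
          using F z by (auto simp: antiderivative_on_def intro!: derivative_eq_intros)
      qed (use f1 in auto)
      then show ?thesis
        using True by auto
    next
      case False
      then show ?thesis
        using rec[rule_format, of "Suc k"] by (auto simp: antiderivative_on_def)
    qed
    \<comment> \<open>Differentiating the product of \<Lambda> and \<open>h\<close> yields a term
      with \<open>h\<close> that cancels against the first-order term by the equation for \<Lambda>;
      what remains is \<Psi> \<Lambda> times the derivative of \<open>h\<close>. This covers both
      the recursion and the harmonicity of \<open>f 1\<close>.\<close>
    have op: "deriv (f (Suc k)) z * \<Phi> z + deriv (deriv (f (Suc k))) z * \<Psi> z = (if k = 0 then 0 else f k z)"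
      if z: "z \<in> V" for k z
    proof -
      obtain h where "\<forall>z\<in>V. (f (Suc k) has_field_derivative \<Lambda> z * h z) (at z)"
        "\<forall>z\<in>V. (h has_field_derivative (if k = 0 then 0 else f k z / (\<Lambda> z * \<Psi> z))) (at z)"
        using df[of k] by (elim exE conjE)
      note h = this[rule_format]
      have "deriv (deriv (f (Suc k))) z = deriv (\<lambda>z. \<Lambda> z * h z) z"
        using h(1) by (intro deriv_eq_on_open[OF V z]) (auto intro: DERIV_imp_deriv)
      also have "\<dots> = \<Lambda> z * (if k = 0 then 0 else f k z / (\<Lambda> z * \<Psi> z)) - (\<Phi> z / \<Psi> z) * \<Lambda> z * h z"
        using DERIV_mult[OF d\<Lambda>[OF z] h(2)[OF z]]
        by (intro DERIV_imp_deriv) (simp add: algebra_simps)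
      finally show ?thesis
        using DERIV_imp_deriv[OF h(1)[OF z]] VU \<Lambda> z
        by (auto simp: field_simps)
    qed
    have hol: "f (Suc k) holomorphic_on V" for k
      using df[of k] V by (auto simp: holomorphic_on_open)
    show ?thesis
    proof (rule proper_r_harmonic_on_chain[where f = "\<lambda>k. f (Suc k)", OF \<phi> V hol])
      show "\<not> (\<forall>p\<in>{p \<in> topspace X. \<phi> p \<in> V}. f (Suc 0) (\<phi> p) = 0)"
      proof
        assume zero: "\<forall>p\<in>{p \<in> topspace X. \<phi> p \<in> V}. f (Suc 0) (\<phi> p) = 0"
        from ne obtain p where p: "p \<in> topspace X" "\<phi> p \<in> V"
          by blast
        \<comment> \<open>If \<open>c\<^sub>1\<close> were 0, \<open>f 1\<close> would be the
          constant \<open>c\<^sub>2\<close> on \<open>V\<close>; its vanishing at \<phi>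
          \<open>p\<close> would make both constants 0.\<close>
        have "c\<^sub>1 \<noteq> 0"
          using c f1 zero p by auto
        moreover have "deriv (f (Suc 0)) (\<phi> p) = \<Lambda> (\<phi> p) * c\<^sub>1"
          using df[of 0] p by (auto intro: DERIV_imp_deriv)
        \<comment> \<open>\<Lambda> is an exponential on \<open>V\<close> and has no zeros
          there.\<close>
        ultimately have "deriv (f (Suc 0)) (\<phi> p) \<noteq> 0"
          using \<Lambda> p by simp
        then have "conformality A g \<phi> \<phi> p = 0"
          using zero by (intro conformality_eq_0_if_compose_constant[OF \<phi> V hol p]) auto
        \<comment> \<open>The conformality operator at \<open>p\<close> equals \<Psi> at \<phi>
          \<open>p\<close>, which is nonzero because \<open>V\<close> avoids the zeros of
          \<Psi>.\<close>
        then show False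
          using \<kappa> VU p by auto
      qed
    qed (simp_all add: \<tau> \<kappa> op)
  qed
  then show ?thesis
    by (metis One_nat_def Suc_le_D)
qed

end
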